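(* For all integers $a,b\geq 1$, the set of return words of $0$ in $\mathfrak{F}^{(a,b)}$ is exactly $\{\,0,\ 01\,\}$.
   Context: Words are over the alphabet $\{0,1\}$. For integers $a,b\geq 1$ let $\mathfrak{F}^{(a,b)}_0=1$, $\mathfrak{F}^{(a,b)}_1=0$, and for $n\geq 2$: $\mathfrak{F}^{(a,b)}_n=(\mathfrak{F}^{(a,b)}_{n-1})^a\,\mathfrak{F}^{(a,b)}_{n-2}$ if $n$ is even, $\mathfrak{F}^{(a,b)}_n=(\mathfrak{F}^{(a,b)}_{n-1})^b\,\mathfrak{F}^{(a,b)}_{n-2}$ if $n$ is odd. The infinite word $\mathfrak{F}^{(a,b)}=\lim_{n\to\infty}\mathfrak{F}^{(a,b)}_n$ is the unique infinite word having every $\mathfrak{F}^{(a,b)}_n$, $n\geq 1$, as a prefix. If $u$ is a factor of an infinite word $w$ and $p_0<p_1<p_2<\cdots$ are all the positions at which $u$ occurs in $w$, the return words of $u$ in $w$ are the factors $w[p_i,p_{i+1})$, $i\geq 0$ (from position $p_i$ up to but not including position $p_{i+1}$). *)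

theory Defs
  imports "HOL-Library.Omega_Words_Fun" "HOL-Library.Z2"
begin

text \<open>
  The alphabet \<open>{0,1}\<close> is the two-element type \<^typ>\<open>bit\<close> (only its two constants are used, not
  its field structure). Finite words are lists, infinite words are functions on \<^typ>\<open>nat\<close>;
  positions start at \<open>0\<close>.
\<close>

definition word_power :: "'a list \<Rightarrow> nat \<Rightarrow> 'a list" where
  "word_power u k = concat (replicate k u)"

fun fib_word_fin :: "nat \<Rightarrow> nat \<Rightarrow> nat \<Rightarrow> bit list" where
  "fib_word_fin a b 0 = [1]"
| "fib_word_fin a b (Suc 0) = [0]"
| "fib_word_fin a b (Suc (Suc n)) =
     (if even (Suc (Suc n))
      then word_power (fib_word_fin a b (Suc n)) a @ fib_word_fin a b n
      else word_power (fib_word_fin a b (Suc n)) b @ fib_word_fin a b n)"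

text \<open>
  The description below picks out a unique word only when \<open>a, b \<ge> 1\<close>. The index \<open>n = 0\<close> is
  excluded since \<open>fib_word_fin a b 0\<close> is not a prefix of the limit.
\<close>

definition fib_word :: "nat \<Rightarrow> nat \<Rightarrow> bit word" where
  "fib_word a b =
     (THE w. \<forall>n\<ge>1. prefix (length (fib_word_fin a b n)) w = fib_word_fin a b n)"

definition occurrences :: "'a list \<Rightarrow> 'a word \<Rightarrow> nat set" where
  "occurrences u w = {p. w [p \<rightarrow> p + length u] = u}"

text \<open>
  The sequence \<open>p 0 < p 1 < \<dots>\<close> of all occurrences is unique if it exists, which is the case iff
  \<open>u\<close> occurs infinitely often in \<open>w\<close>; otherwise the set below is empty.
\<close>

definition return_words :: "'a list \<Rightarrow> 'a word \<Rightarrow> 'a list set" where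
  "return_words u w =
     {w [p i \<rightarrow> p (Suc i)] | p i. strict_mono p \<and> range p = occurrences u w}"

end

theory Submission
  imports Defs
begin

text \<open>
  The return words of \<open>0\<close> only depend on how far apart consecutive zeros are. The infinite word
  starts with \<open>0\<close> and never contains \<open>11\<close>, so the zero following a given one is one or two
  positions further, and the corresponding return word is \<open>0\<close> or \<open>01\<close>
  (\<open>return_words_of_zero\<close>). Both of them occur as soon as both \<open>00\<close> and \<open>01\<close> are factors.

  The factor \<open>11\<close> is avoided because, from index \<open>1\<close> on, every finite word starts with \<open>0\<close> and
  avoids \<open>11\<close>, and words with these two properties are closed under concatenation: no \<open>11\<close> can
  appear at a seam. Only the word of index \<open>2\<close>, which is \<open>0\<^sup>a1\<close>, needs a separate look, as it ends
  with the word of index \<open>0\<close>. This word also provides the factor \<open>01\<close>. The factor \<open>00\<close> is found in the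
  word of index \<open>4\<close>, at the end of its first copy of the word of index \<open>3\<close>: that copy ends with \<open>0\<close>,
  and what follows it starts with \<open>0\<close>.
\<close>

section \<open>Powers of words\<close>

lemma word_power_simps [simp]:
  "word_power u 0 = []"
  "word_power u (Suc k) = u @ word_power u k"
  by (simp_all add: word_power_def)

lemma word_power_singleton: "word_power [x] k = replicate k x"
  by (induction k) auto

lemma word_power_split_first:
  assumes "k \<ge> 1"
  shows "word_power u k = u @ word_power u (k - 1)"
  using assms by (cases k) auto

section \<open>The infinite word as a limit of its prefixes\<close>

text \<open>
  Since \<open>a\<close> and \<open>b\<close> are positive, a first copy of the preceding word can be split off, whatever the
  parity of the index. This makes each word, from index \<open>1\<close> on, a prefix of the next one.
\<close>

lemma fib_word_fin_step:
  assumes "a \<ge> 1" "b \<ge> 1"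
  obtains k where "fib_word_fin a b (Suc (Suc n)) =
    fib_word_fin a b (Suc n) @ word_power (fib_word_fin a b (Suc n)) k @ fib_word_fin a b n"
proof (rule that)
  show "fib_word_fin a b (Suc (Suc n)) = fib_word_fin a b (Suc n) @
    word_power (fib_word_fin a b (Suc n)) ((if even n then a else b) - 1) @ fib_word_fin a b n"
    using assms by (simp add: word_power_split_first)
qed

lemma fib_word_fin_nonempty:
  assumes "a \<ge> 1" "b \<ge> 1"
  shows "fib_word_fin a b n \<noteq> []"
proof (induction n rule: less_induct)
  case (less n)
  show ?case
  proof (cases "n \<le> 1")
    case True
    then show ?thesis by (cases n) auto
  next
    case False
    then obtain m where "n = Suc (Suc m)"
      by (metis One_nat_def not0_implies_Suc le_simps(2) not_less_eq_eq zero_le)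
    moreover have "fib_word_fin a b (Suc (Suc m)) \<noteq> []"
      by (rule fib_word_fin_step[OF assms, of m]) (use less calculation in auto)
    ultimately show ?thesis by simp
  qed
qed

lemma length_fib_word_fin_ge:
  assumes "a \<ge> 1" "b \<ge> 1"
  shows "length (fib_word_fin a b (Suc n)) \<ge> Suc n"
proof (induction n)
  case (Suc n)
  let ?F = "fib_word_fin a b"
  obtain k where "?F (Suc (Suc n)) = ?F (Suc n) @ word_power (?F (Suc n)) k @ ?F n"
    by (rule fib_word_fin_step[OF assms])
  then have "length (?F (Suc (Suc n))) \<ge> length (?F (Suc n)) + length (?F n)"
    by (simp del: fib_word_fin.simps)
  moreover have "length (?F n) > 0"
    using fib_word_fin_nonempty[OF assms] by simp
  ultimately show ?case
    using Suc by linarith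
qed simp

lemma fib_word_fin_prefix_mono:
  assumes "a \<ge> 1" "b \<ge> 1" and "m \<le> n"
  obtains v where "fib_word_fin a b (Suc n) = fib_word_fin a b (Suc m) @ v"
proof -
  from \<open>m \<le> n\<close> have "\<exists>v. fib_word_fin a b (Suc n) = fib_word_fin a b (Suc m) @ v"
  proof (induction n rule: dec_induct)
    case (step n)
    show ?case
      by (rule fib_word_fin_step[OF assms(1,2), of n]) (use step.IH in auto)
  qed simp
  with that show thesis by blast
qed

lemma fib_word_fin_nth_unique:
  assumes "a \<ge> 1" "b \<ge> 1"
    and "i < length (fib_word_fin a b (Suc m))" "i < length (fib_word_fin a b (Suc n))"
  shows "fib_word_fin a b (Suc m) ! i = fib_word_fin a b (Suc n) ! i"
proof (cases "m \<le> n")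
  case True
  show ?thesis
    by (rule fib_word_fin_prefix_mono[OF assms(1,2) True]) (simp add: assms(3) nth_append)
next
  case False
  then have "n \<le> m" by simp
  show ?thesis
    by (rule fib_word_fin_prefix_mono[OF assms(1,2) \<open>n \<le> m\<close>]) (simp add: assms(4) nth_append)
qed

text \<open>
  The description defining the infinite word is satisfied by exactly one word, because the prefixes
  agree with each other and get arbitrarily long; hence its letters can be read off from them.
\<close>

lemma fib_word_nth:
  assumes "a \<ge> 1" "b \<ge> 1" and i: "i < length (fib_word_fin a b (Suc n))"
  shows "fib_word a b i = fib_word_fin a b (Suc n) ! i"
proof -
  let ?F = "fib_word_fin a b"
  \<comment> \<open>The word of index \<open>i + 1\<close> has length at least \<open>i + 1\<close>, so it has a letter at position \<open>i\<close>.\<close>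
  define w where "w = (\<lambda>i. ?F (Suc i) ! i)"
  have w_nth: "w i = ?F (Suc n) ! i" if "i < length (?F (Suc n))" for i n
    unfolding w_def
    using fib_word_fin_nth_unique[OF assms(1,2) _ that] length_fib_word_fin_ge[OF assms(1,2), of i]
    by simp
  have "fib_word a b = w"
    unfolding fib_word_def
  proof (rule the_equality)
    show "\<forall>n\<ge>1. prefix (length (?F n)) w = ?F n"
    proof (intro allI impI)
      fix n :: nat
      assume "n \<ge> 1"
      then obtain m where "n = Suc m" by (cases n) auto
      then show "prefix (length (?F n)) w = ?F n"
        by (intro nth_equalityI) (auto simp: w_nth simp del: fib_word_fin.simps)
    qed
  next
    fix v
    assume v: "\<forall>n\<ge>1. prefix (length (?F n)) v = ?F n"
    show "v = w"
    proof
      fix i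
      have lt: "i < length (?F (Suc i))"
        using length_fib_word_fin_ge[OF assms(1,2), of i] by simp
      have "v i = prefix (length (?F (Suc i))) v ! i"
        using lt by (simp del: fib_word_fin.simps)
      also have "\<dots> = w i"
        using v by (simp add: w_def del: fib_word_fin.simps)
      finally show "v i = w i" .
    qed
  qed
  with w_nth[OF i] show ?thesis by simp
qed

section \<open>Words that start with zero and avoid two consecutive ones\<close>

definition ones_isolated :: "bit list \<Rightarrow> bool" where
  "ones_isolated u \<longleftrightarrow> u \<noteq> [] \<and> hd u = 0 \<and> successively (\<lambda>x y. x = 0 \<or> y = 0) u"

lemma ones_isolated_append:
  assumes "ones_isolated u" "ones_isolated v"
  shows "ones_isolated (u @ v)"
  using assms by (auto simp: ones_isolated_def successively_append_iff)

lemma ones_isolated_power_append: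
  assumes "ones_isolated u" "ones_isolated v"
  shows "ones_isolated (word_power u k @ v)"
  using assms by (induction k) (auto intro: ones_isolated_append)

lemma ones_isolated_zeros_one:
  assumes "k \<ge> 1"
  shows "ones_isolated (replicate k 0 @ [1])"
proof -
  have "successively (\<lambda>x y. x = 0 \<or> y = 0) (replicate k (0 :: bit) @ [1])" for k
  proof (induction k)
    case (Suc k)
    then show ?case by (cases k) auto
  qed simp
  from this[of k] assms show ?thesis by (cases k) (auto simp: ones_isolated_def)
qed

lemma fib_word_fin_2: "fib_word_fin a b 2 = replicate a 0 @ [1]"
  by (simp add: numeral_2_eq_2 word_power_singleton)

lemma ones_isolated_fib_word_fin:
  assumes "a \<ge> 1" "b \<ge> 1"
  shows "ones_isolated (fib_word_fin a b (Suc n))"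
proof (induction n rule: less_induct)
  case (less n)
  consider "n = 0" | "n = 1" | m where "n = Suc (Suc m)"
    by (cases n; cases "n - 1") auto
  then show ?case
  proof cases
    case 1
    then show ?thesis by (simp add: ones_isolated_def)
  next
    case 2
    then show ?thesis
      using ones_isolated_zeros_one[OF assms(1)] fib_word_fin_2[of a b]
      by (simp add: numeral_2_eq_2 del: fib_word_fin.simps)
  next
    case (3 m)
    then have "ones_isolated (fib_word_fin a b (Suc (Suc m)))"
      "ones_isolated (fib_word_fin a b (Suc m))"
      using less by (auto simp del: fib_word_fin.simps)
    then show ?thesis
      unfolding 3 fib_word_fin.simps(3)[of a b "Suc m"]
      by (simp add: ones_isolated_power_append del: fib_word_fin.simps)
  qed
qed

section \<open>Factors of length two of the infinite word\<close>

lemma fib_word_no_11: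
  assumes "a \<ge> 1" "b \<ge> 1"
  shows "fib_word a b i = 0 \<or> fib_word a b (Suc i) = 0"
proof -
  let ?u = "fib_word_fin a b (Suc (Suc i))"
  have len: "Suc i < length ?u"
    using length_fib_word_fin_ge[OF assms, of "Suc i"] by simp
  have "successively (\<lambda>x y. x = 0 \<or> y = 0) ?u"
    using ones_isolated_fib_word_fin[OF assms, of "Suc i"] by (simp add: ones_isolated_def)
  then have "?u ! i = 0 \<or> ?u ! Suc i = 0"
    using len by (auto simp: successively_conv_nth simp del: fib_word_fin.simps)
  then show ?thesis
    using fib_word_nth[OF assms, of i "Suc i"] fib_word_nth[OF assms len] len by simp
qed

lemma fib_word_has_01:
  assumes "a \<ge> 1" "b \<ge> 1"
  shows "\<exists>i. fib_word a b i = 0 \<and> fib_word a b (Suc i) = 1"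
proof -
  have F2: "fib_word_fin a b (Suc 1) = replicate a 0 @ [1]"
    using fib_word_fin_2[of a b] by (simp add: numeral_2_eq_2)
  have "fib_word a b (a - 1) = 0"
    by (subst fib_word_nth[OF assms, of _ 1], unfold F2) (use assms in \<open>auto simp: nth_append\<close>)
  moreover have "fib_word a b a = 1"
    by (subst fib_word_nth[OF assms, of _ 1], unfold F2) (auto simp: nth_append)
  ultimately show ?thesis
    using assms by (intro exI[of _ "a - 1"]) simp
qed

lemma fib_word_has_00:
  assumes "a \<ge> 1" "b \<ge> 1"
  shows "\<exists>i. fib_word a b i = 0 \<and> fib_word a b (Suc i) = 0"
proof -
  let ?F = "fib_word_fin a b"
  define p where "p = word_power (?F 2) b"
  define r where "r = word_power (?F 3) (a - 1) @ ?F 2"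
  have "?F (Suc (Suc 1)) = word_power (?F (Suc 1)) b @ ?F 1"
    by (subst fib_word_fin.simps(3)) simp
  then have F3: "?F 3 = p @ [0]"
    by (simp only: p_def Suc_1 flip: numeral_3_eq_3) (simp add: eval_nat_numeral)
  have "?F (Suc (Suc 2)) = word_power (?F (Suc 2)) a @ ?F 2"
    by (subst fib_word_fin.simps(3)) simp
  then have "?F (Suc 3) = word_power (?F 3) a @ ?F 2"
    by (simp only: eval_nat_numeral)
  then have F4: "?F (Suc 3) = p @ 0 # r"
    using assms(1) by (simp add: word_power_split_first r_def F3)
  have "ones_isolated (?F (Suc 2))" "ones_isolated (?F (Suc 1))"
    using ones_isolated_fib_word_fin[OF assms] by blast+
  then have "ones_isolated r"
    unfolding r_def
    by (intro ones_isolated_power_append) (simp_all add: eval_nat_numeral del: fib_word_fin.simps)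
  then obtain s where r: "r = 0 # s"
    by (cases r) (auto simp: ones_isolated_def)
  have "fib_word a b (length p) = 0" "fib_word a b (Suc (length p)) = 0"
    by (subst fib_word_nth[OF assms, of _ 3], unfold F4 r, auto simp: nth_append)+
  then show ?thesis by blast
qed

section \<open>Return words of zero\<close>

lemma subsequence_two: "w [i \<rightarrow> Suc (Suc i)] = [w i, w (Suc i)]"
  by (simp add: subsequence_def)

text \<open>
  Whatever enumeration of the occurrences is chosen, its next value is the least occurrence above
  the current one: a smaller one would have to be enumerated at an index strictly between \<open>i\<close> and
  \<open>i + 1\<close>.
\<close>

lemma strict_mono_range_next:
  fixes p :: "nat \<Rightarrow> nat"
  assumes "strict_mono p" and "q \<in> range p" "p i < q"
  shows "p (Suc i) \<le> q"
  using assms by (auto simp: strict_mono_less strict_mono_less_eq)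

lemma return_words_of_zero:
  fixes w :: "bit word"
  assumes no_11: "\<And>i. w i = 0 \<or> w (Suc i) = 0"
    and has_00: "\<exists>i. w i = 0 \<and> w (Suc i) = 0"
    and has_01: "\<exists>i. w i = 0 \<and> w (Suc i) = 1"
  shows "return_words [0] w = {[0], [0, 1]}"
proof -
  have occ: "occurrences [0] w = {i. w i = 0}"
    by (simp add: occurrences_def)
  have return_word: "w [p i \<rightarrow> p (Suc i)] = (if w (Suc (p i)) = 0 then [0] else [0, 1])"
    if p: "strict_mono p" "range p = {i. w i = 0}" for p i
  proof -
    have zero: "w (p j) = 0" for j
      using p(2) by blast
    have less: "p i < p (Suc i)"
      using p(1) by (simp add: strict_mono_less)
    show ?thesis
    proof (cases "w (Suc (p i)) = 0")
      case True
      then have "p (Suc i) \<le> Suc (p i)"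
        using strict_mono_range_next[OF p(1)] p(2) by simp
      with less have "p (Suc i) = Suc (p i)" by simp
      with True zero show ?thesis by simp
    next
      case False
      then have one: "w (Suc (p i)) = 1" by simp
      have "w (Suc (Suc (p i))) = 0"
        using no_11[of "Suc (p i)"] False by simp
      then have "p (Suc i) \<le> Suc (Suc (p i))"
        using strict_mono_range_next[OF p(1)] p(2) by simp
      moreover have "p (Suc i) \<noteq> Suc (p i)"
        using zero[of "Suc i"] one by auto
      ultimately have "p (Suc i) = Suc (Suc (p i))"
        using less by simp
      with one zero show ?thesis by (simp add: subsequence_two)
    qed
  qed
  have inf: "infinite {i. w i = 0}"
    unfolding infinite_nat_iff_unbounded
  proof
    fix m
    show "\<exists>n>m. n \<in> {i. w i = 0}"
    proof (cases "w (Suc m) = 0")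
      case True
      then show ?thesis by (intro exI[of _ "Suc m"]) simp
    next
      case False
      then show ?thesis using no_11[of "Suc m"] by (intro exI[of _ "Suc (Suc m)"]) simp
    qed
  qed
  obtain p :: "nat \<Rightarrow> nat" where p: "strict_mono p" "range p = {i. w i = 0}"
    by (rule that[OF strict_mono_enumerate[OF inf] range_enumerate[OF inf]])
  have member: "(if w (Suc q) = 0 then [0] else [0, 1]) \<in> return_words [0] w" if "w q = 0" for q
  proof -
    have "q \<in> range p"
      using that p(2) by simp
    then obtain i where "q = p i" ..
    then have "(if w (Suc q) = 0 then [0] else [0, 1]) = w [p i \<rightarrow> p (Suc i)]"
      by (simp only: return_word[OF p])
    with p show ?thesis
      unfolding return_words_def occ mem_Collect_eq by (intro exI[of _ p] exI[of _ i] conjI)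
  qed
  show ?thesis
  proof
    show "return_words [0] w \<subseteq> {[0], [0, 1]}"
    proof
      fix v
      assume "v \<in> return_words [0] w"
      then obtain p i where "v = w [p i \<rightarrow> p (Suc i)]" "strict_mono p" "range p = {i. w i = 0}"
        unfolding return_words_def occ mem_Collect_eq by (elim exE conjE)
      then show "v \<in> {[0], [0, 1]}"
        by (simp only: return_word) simp
    qed
    obtain i j where "w i = 0" "w (Suc i) = 0" "w j = 0" "w (Suc j) = 1"
      using has_00 has_01 by blast
    then show "{[0], [0, 1]} \<subseteq> return_words [0] w"
      using member[of i] member[of j] by simp
  qed
qed

theorem theorem4p8:
  fixes a b :: nat
  assumes "a \<ge> 1" and "b \<ge> 1"
  shows "return_words [0] (fib_word a b) = {[0], [0, 1]}"
  using fib_word_no_11[OF assms] fib_word_has_00[OF assms] fib_word_has_01[OF assms]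
  by (rule return_words_of_zero)

end
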